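(* Let $A,B\subset\mathcal{E}$ both be closed, let $\lambda\in(0,1)$, and let $T_{\mathrm{DR}\lambda}$ be single-valued at its fixed points on an open set $U\subset\mathcal{E}$ (that is, $T_{\mathrm{DR}\lambda}(x)$ is a singleton for every fixed point $x$ of $T_{\mathrm{DR}\lambda}$ in $U$). Let $x\in\operatorname{Fix}T_{\mathrm{DR}\lambda}\cap U$. Then $$\{x\}=P_B(x)-\frac{\lambda}{1-\lambda}\big(P_B(x)-P_A(P_B(x))\big).$$
   Context: $\mathcal{E}$ is a finite-dimensional Euclidean space. For $C\subset\mathcal{E}$ the projector is the set-valued map $P_C(x)=\{z\in C:\|z-x\|=\inf_{y\in C}\|x-y\|\}$ and the reflector is the set-valued map $R_C(x)=2P_C(x)-x$; for a set $D$, $P_C(D)=\bigcup_{x\in D}P_C(x)$. The relaxed Douglas–Rachford mapping is the set-valued map $T_{\mathrm{DR}\lambda}(x)=\left\{\tfrac{\lambda}{2}\big(R_A(2b-x)+x\big)+(1-\lambda)b : b\in P_B(x)\right\}$. $\operatorname{Fix}T=\{x\in\mathcal{E}:x\in T(x)\}$.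
   Formalization: The right-hand side is read with one common b in P_B(x) and a in P_A(b), as the union of b − λ/(1−λ)(b − a); with independent selections the formula fails: A={0}, B={−1,1}, λ=1/2, x=0 gives {−2,0,2}. Both agree when P_B(x) is a singleton. *)

theory Defs
  imports "HOL-Analysis.Analysis"
begin

definition projector :: "'a::euclidean_space set \<Rightarrow> 'a \<Rightarrow> 'a set" where
  "projector C x = {z \<in> C. norm (z - x) = (INF y\<in>C. norm (x - y))}"

definition reflector :: "'a::euclidean_space set \<Rightarrow> 'a \<Rightarrow> 'a set" where
  "reflector C x = {2 *\<^sub>R z - x | z. z \<in> projector C x}"

definition T_DR :: "'a::euclidean_space set \<Rightarrow> 'a set \<Rightarrow> real \<Rightarrow> 'a \<Rightarrow> 'a set" where
  "T_DR A B lam x =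
     {(lam / 2) *\<^sub>R (r + x) + (1 - lam) *\<^sub>R b | b r.
        b \<in> projector B x \<and> r \<in> reflector A (2 *\<^sub>R b - x)}"

definition Fix :: "('a \<Rightarrow> 'a set) \<Rightarrow> 'a set" where
  "Fix T = {x. x \<in> T x}"

text \<open>
  The set-valued expression \<open>P\<^sub>B x - lam/(1-lam) (P\<^sub>B x - P\<^sub>A (P\<^sub>B x))\<close>,
  read like \<open>T_DR\<close> with one and the same selection \<open>b \<in> P\<^sub>B x\<close> in all
  places, i.e. as the mapping \<open>Id - lam/(1-lam) (Id - P\<^sub>A)\<close> applied to the set \<open>P\<^sub>B x\<close>.
  Independent (Minkowski) selections give the same set when \<open>P\<^sub>B x\<close> is a singleton, but
  \<open>P\<^sub>B\<close> can be multivalued at a fixed point where \<open>T_DR\<close> is single-valued: for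
  \<open>A = {0}\<close>, \<open>B = {-1, 1}\<close> on the real line and \<open>lam = 1/2\<close>, \<open>T_DR\<close> is \<open>x \<mapsto> {x/2}\<close>,
  while at \<open>x = 0\<close> independent selections would yield \<open>{-2, 0, 2}\<close>.
\<close>

definition DR_fix_expr :: "'a::euclidean_space set \<Rightarrow> 'a set \<Rightarrow> real \<Rightarrow> 'a \<Rightarrow> 'a set" where
  "DR_fix_expr A B lam x =
     (\<Union>b\<in>projector B x. {b - (lam / (1 - lam)) *\<^sub>R (b - a) | a. a \<in> projector A b})"

end

theory Submission
  imports Defs
begin

text \<open>
  Write \<open>\<kappa> = lam / (1 - lam)\<close>. Single-valuedness at \<open>x\<close> says that \<open>x = b - \<kappa> (b - a)\<close> for all
  \<open>b \<in> P\<^sub>B x\<close> and \<open>a \<in> P\<^sub>A (2 b - x)\<close>. Then \<open>2 b - x = b + \<kappa> (b - a)\<close>, so \<open>b\<close> lies on the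
  segment from \<open>2 b - x\<close> to its nearest point \<open>a\<close>. By the triangle inequality \<open>a\<close> is also nearest
  to \<open>b\<close>, and every point of \<open>A\<close> nearest to \<open>b\<close> is nearest to \<open>2 b - x\<close>; hence \<open>P\<^sub>A (2 b - x)\<close>
  may be replaced by \<open>P\<^sub>A b\<close>.
\<close>

lemma projector_iff:
  "z \<in> projector C x \<longleftrightarrow> z \<in> C \<and> (\<forall>y\<in>C. norm (x - z) \<le> norm (x - y))"
proof (cases "z \<in> C")
  case True
  have bdd: "bdd_below ((\<lambda>y. norm (x - y)) ` C)"
    by (rule bdd_belowI2[of _ 0]) simp
  have "(INF y\<in>C. norm (x - y)) \<le> norm (x - z)"
    using bdd True by (rule cINF_lower)
  moreover have "norm (x - z) \<le> (INF y\<in>C. norm (x - y)) \<longleftrightarrow> (\<forall>y\<in>C. norm (x - z) \<le> norm (x - y))"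
    using bdd True by (subst le_cINF_iff) auto
  ultimately show ?thesis
    using True by (auto simp: projector_def norm_minus_commute[of z x])
qed (simp add: projector_def)

lemma projector_nonempty:
  assumes "closed C" "C \<noteq> {}"
  shows "projector C x \<noteq> {}"
proof -
  obtain z where "z \<in> C" "\<And>y. y \<in> C \<Longrightarrow> dist x z \<le> dist x y"
    using distance_attains_inf[OF assms] by blast
  then have "z \<in> projector C x"
    by (auto simp: projector_iff dist_norm)
  then show ?thesis by blast
qed

lemma projector_on_ray:
  assumes a: "a \<in> projector C (b + k *\<^sub>R (b - a))" and k: "0 \<le> k"
  shows "a \<in> projector C b" and "projector C b \<subseteq> projector C (b + k *\<^sub>R (b - a))"
proof -
  define p where "p = b + k *\<^sub>R (b - a)"
  have "p - a = (1 + k) *\<^sub>R (b - a)" "p - b = k *\<^sub>R (b - a)"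
    by (simp_all add: p_def algebra_simps)
  then have split: "norm (p - a) = norm (p - b) + norm (b - a)"
    using k by (simp only: norm_scaleR) (simp add: distrib_right)
  have tri: "norm (p - y) \<le> norm (p - b) + norm (b - y)" for y
    using norm_triangle_ineq[of "p - b" "b - y"] by simp
  have mem: "a \<in> C" and near: "\<And>y. y \<in> C \<Longrightarrow> norm (p - a) \<le> norm (p - y)"
    using a by (auto simp: projector_iff p_def)
  have "norm (b - a) \<le> norm (b - y)" if "y \<in> C" for y
    using near[OF that] split tri[of y] by linarith
  with mem show "a \<in> projector C b"
    by (simp add: projector_iff)
  show "projector C b \<subseteq> projector C (b + k *\<^sub>R (b - a))"
  proof
    fix y assume y: "y \<in> projector C b"
    then have "norm (b - y) \<le> norm (b - a)"
      using mem by (simp add: projector_iff)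
    then have "norm (p - y) \<le> norm (p - a)"
      using split tri[of y] by linarith
    then have "norm (p - y) \<le> norm (p - z)" if "z \<in> C" for z
      using near[OF that] by linarith
    then show "y \<in> projector C (b + k *\<^sub>R (b - a))"
      using y by (simp add: projector_iff p_def)
  qed
qed

lemma scaleR_one_minus_double:
  fixes b :: "'a::real_vector"
  shows "(1 - 2 * lam) *\<^sub>R b = b - lam *\<^sub>R b - lam *\<^sub>R b"
proof -
  have "(2 * lam) *\<^sub>R b = lam *\<^sub>R b + lam *\<^sub>R b"
    by (metis scaleR_scaleR scaleR_2)
  then show ?thesis
    by (simp add: scaleR_diff_left)
qed

lemma mem_T_DR_iff:
  "t \<in> T_DR A B lam x \<longleftrightarrow>
     (\<exists>b\<in>projector B x. \<exists>a\<in>projector A (2 *\<^sub>R b - x).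
        t = lam *\<^sub>R x + (lam *\<^sub>R a + (1 - 2 * lam) *\<^sub>R b))"
proof -
  have "(lam / 2) *\<^sub>R ((2 *\<^sub>R a - (2 *\<^sub>R b - x)) + x) + (1 - lam) *\<^sub>R b
      = lam *\<^sub>R x + (lam *\<^sub>R a + (1 - 2 * lam) *\<^sub>R b)" for a b :: 'a
  proof -
    have "(2 *\<^sub>R a - (2 *\<^sub>R b - x)) + x = 2 *\<^sub>R (a - b + x)"
      by (simp add: algebra_simps scaleR_2)
    then have "(lam / 2) *\<^sub>R ((2 *\<^sub>R a - (2 *\<^sub>R b - x)) + x) = lam *\<^sub>R (a - b + x)"
      by simp
    then show ?thesis
      by (simp only: scaleR_one_minus_double) (simp add: scaleR_add_right scaleR_diff_right scaleR_diff_left)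
  qed
  note eq = this[symmetric]
  show ?thesis
    unfolding T_DR_def reflector_def eq by blast
qed

lemma DR_fixed_point_eq_iff:
  fixes x a b :: "'a::real_vector"
  assumes "lam < 1"
  shows "x = lam *\<^sub>R x + (lam *\<^sub>R a + (1 - 2 * lam) *\<^sub>R b) \<longleftrightarrow>
         x = b - (lam / (1 - lam)) *\<^sub>R (b - a)"
proof -
  have "lam *\<^sub>R a + (1 - 2 * lam) *\<^sub>R b = (1 - lam) *\<^sub>R b - lam *\<^sub>R (b - a)"
    by (simp only: scaleR_one_minus_double) (simp add: scaleR_diff_right scaleR_diff_left)
  also have "\<dots> = (1 - lam) *\<^sub>R (b - (lam / (1 - lam)) *\<^sub>R (b - a))"
    using assms by (simp add: scaleR_diff_right[of "1 - lam" b])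
  finally have "lam *\<^sub>R a + (1 - 2 * lam) *\<^sub>R b =
      (1 - lam) *\<^sub>R (b - (lam / (1 - lam)) *\<^sub>R (b - a))" .
  moreover have "x = lam *\<^sub>R x + (lam *\<^sub>R a + (1 - 2 * lam) *\<^sub>R b) \<longleftrightarrow>
      (1 - lam) *\<^sub>R x = lam *\<^sub>R a + (1 - 2 * lam) *\<^sub>R b"
    by (simp only: scaleR_diff_left[of 1 lam x] scaleR_one diff_eq_eq add.commute)
  ultimately show ?thesis
    using assms by simp
qed

theorem corollary3p15:
  fixes A B U :: "'a::euclidean_space set" and lam :: real and x :: 'a
  assumes "closed A" and "closed B"
    and "0 < lam" and "lam < 1"
    and "open U"
    and "\<And>y. y \<in> Fix (T_DR A B lam) \<inter> U \<Longrightarrow> is_singleton (T_DR A B lam y)"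
    and "x \<in> Fix (T_DR A B lam) \<inter> U"
  shows "{x} = DR_fix_expr A B lam x"
proof -
  define k where "k = lam / (1 - lam)"
  have k: "0 \<le> k"
    using assms(3,4) by (simp add: k_def)
  have x_mem: "x \<in> T_DR A B lam x"
    using assms(7) by (simp add: Fix_def)
  with assms(6)[OF assms(7)] have single: "T_DR A B lam x = {x}"
    by (auto simp: is_singleton_def)
  have x_eq: "x = b - k *\<^sub>R (b - a)"
    if "b \<in> projector B x" "a \<in> projector A (2 *\<^sub>R b - x)" for a b
  proof -
    have "lam *\<^sub>R x + (lam *\<^sub>R a + (1 - 2 * lam) *\<^sub>R b) \<in> T_DR A B lam x"
      using that mem_T_DR_iff by blast
    then show ?thesis
      using single DR_fixed_point_eq_iff[OF assms(4), of x a b] by (simp add: k_def)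
  qed
  have "projector B x \<noteq> {}" and "A \<noteq> {}"
    using x_mem by (auto simp: mem_T_DR_iff projector_iff)
  have "{b - k *\<^sub>R (b - a) | a. a \<in> projector A b} = {x}" if b: "b \<in> projector B x" for b
  proof -
    obtain a where a: "a \<in> projector A (2 *\<^sub>R b - x)"
      using projector_nonempty[OF assms(1) \<open>A \<noteq> {}\<close>] by blast
    have ray: "2 *\<^sub>R b - x = b + k *\<^sub>R (b - a)"
      by (subst x_eq[OF b a]) (simp add: algebra_simps scaleR_2)
    have "a \<in> projector A b" "projector A b \<subseteq> projector A (2 *\<^sub>R b - x)"
      using projector_on_ray[of a A b k] a k by (simp_all add: ray)
    then show ?thesis
      using x_eq[OF b] by blast
  qed
  then show ?thesis
    using \<open>projector B x \<noteq> {}\<close> by (simp add: DR_fix_expr_def k_def)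
qed

end
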